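(* Let $m>t\ge 1$ be integers and let $v,u,d,t',s,q\ge 0$ be integers. Put $\epsilon_j=(2m+1-j)(2m-j-1)$, $\varepsilon_j=(2m-j)(2m-j-2)$ and $\eta_j=(2t-j)(2t-j-2)$. Let $a_{ij}\in\mathbb{Z}$ ($1\le i\le 9$, $1\le j\le 2m+2$) satisfy $a_{1j}=a_{2j}=a_{3j}$, $a_{4j}=a_{5j}=a_{6j}$ and $a_{7j}=a_{8j}=a_{9j}$ for all $j$ occurring in the respective equations. Let $S: Ax=b$, with $A\in M_{9\times(2m+2)}(\mathbb{Z})$, be the linear system in the unknowns $c_1,\dots,c_{2m+2}$ given by $$\sum_{j=0}^{2m-2}(-1)^{j+1}a_{1,j+1}\epsilon_j c_{j+1}+a_{1,2m+1}c_{2m+1}=4d-1,\quad \sum_{j=0}^{2m}(-1)^{j}a_{2,j+1}c_{j+1}=4v-1,\quad \sum_{j=0}^{2m+1}(-1)^{j}a_{3,j+1}c_{j+1}=1,$$ $$\sum_{j=0}^{2m-3}(-1)^{j}a_{4,j+1}\varepsilon_j c_{j+1}+a_{4,2m}c_{2m}=4t'-1,\quad \sum_{j=0}^{2m-1}(-1)^{j+1}a_{5,j+1}c_{j+1}=4u-1,\quad \sum_{j=0}^{2m}(-1)^{j+1}a_{6,j+1}c_{j+1}=1,$$ $$\sum_{j=0}^{2t-1}(-1)^{j+1}a_{7,j+1}c_{j+1}=4s-1,\quad \sum_{j=0}^{2t-3}(-1)^{j}a_{8,j+1}\eta_j c_{j+1}+a_{8,2t}c_{2t}=4q-1,\quad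 \sum_{j=0}^{2t}(-1)^{j+1}a_{9,j+1}c_{j+1}=1 .$$ Let $\{s_1,\dots,s_N\}\subset\mathbb{Z}^{2m+2}$ be the set of integer solutions of $S$. For every solution $s_i=(c_1,\dots,c_{2m+2})$ let $$G_{s_i}: y^2 = a_{31}c_1x^{2m+1}+a_{32}c_2x^{2m}+a_{33}c_3x^{2m-1}+\cdots+a_{3,2m+2}c_{2m+2},$$ $$C_{s_i}: y^2 = a_{61}c_1x^{2m}+a_{62}c_2x^{2m-1}+a_{63}c_3x^{2m-2}+\cdots+a_{6,2m+1}c_{2m+1},$$ $$V_{s_i}: y^2 = a_{91}c_1x^{2t}+a_{92}c_2x^{2t-1}+\cdots+a_{9,2t+1}c_{2t+1},$$ and suppose that these are nonsingular plane algebraic curves of genus $g\ge 0$ with $\deg G_{s_i}=2m+1$, $\deg C_{s_i}=2m$, $\deg V_{s_i}=2t$. If, for each $i$, $x>1$ and $y\ge 1$ hold for all $(x,y)$ in $C_{s_i}(\mathbb{Z}^+)$, in $G_{s_i}(\mathbb{Z}^+)$ and in $V_{s_i}(\mathbb{Z}^+)$, then $C_{s_i}(\mathbb{Z}^+)=\emptyset$, $G_{s_i}(\mathbb{Z}^+)=\emptyset$ and $V_{s_i}(\mathbb{Z}^+)=\emptyset$ for every $i=1,\dots,N$.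
   Context: For a plane curve with integer coefficients, $C(\mathbb{Z}^+)$ denotes the set of pairs $(x,y)$ of positive integers satisfying its equation. Empty sums are $0$. *)

theory Defs
  imports Complex_Main "HOL-Computational_Algebra.Polynomial" "HOL-Library.FuncSet"
begin

text \<open>
  A plane curve with integer coefficients is given by \<open>F \<in> \<int>[x][y]\<close>, encoded as an
  \<open>int poly poly\<close>: the outer variable is \<open>y\<close>, the coefficients are polynomials in \<open>x\<close>.
\<close>

definition eval2 :: "'a::comm_ring_1 poly poly \<Rightarrow> 'a \<Rightarrow> 'a \<Rightarrow> 'a" where
  "eval2 F x y = poly (poly F [:y:]) x"

definition deriv_x :: "'a::idom poly poly \<Rightarrow> 'a poly poly" where
  "deriv_x F = map_poly pderiv F"

definition deriv_y :: "'a::idom poly poly \<Rightarrow> 'a poly poly" where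
  "deriv_y F = pderiv F"

definition complexify :: "int poly poly \<Rightarrow> complex poly poly" where
  "complexify F = map_poly (map_poly of_int) F"

text \<open>
  Nonsingularity of the affine curve over \<open>\<complex>\<close>.  The points at infinity are deliberately left
  out: the projective plane closure of \<open>y\<^sup>2 = f(x)\<close> is singular at infinity as soon as
  \<open>deg f \<ge> 4\<close>.
\<close>

definition nonsingular_curve :: "int poly poly \<Rightarrow> bool" where
  "nonsingular_curve F \<longleftrightarrow>
     (\<forall>x y. eval2 (complexify F) x y = 0 \<longrightarrow>
        eval2 (deriv_x (complexify F)) x y \<noteq> 0 \<or> eval2 (deriv_y (complexify F)) x y \<noteq> 0)"

text \<open>Total degree in \<open>x\<close> and \<open>y\<close>; only meaningful for \<open>F \<noteq> 0\<close>.\<close>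

definition curve_degree :: "'a::zero poly poly \<Rightarrow> nat" where
  "curve_degree F = Max {degree (coeff F k) + k |k. coeff F k \<noteq> 0}"

definition pos_int_points :: "int poly poly \<Rightarrow> (int \<times> int) set" where
  "pos_int_points F = {(x, y). 0 < x \<and> 0 < y \<and> eval2 F x y = 0}"

text \<open>The curve \<open>y\<^sup>2 = f(x)\<close>, i.e. \<open>y\<^sup>2 - f(x) = 0\<close>.\<close>

definition square_curve :: "int poly \<Rightarrow> int poly poly" where
  "square_curve f = [:- f, 0, 1:]"

text \<open>
  \<open>row_poly a i n c\<close> is
  \<open>a\<^sub>i\<^sub>1 c\<^sub>1 x\<^sup>n + a\<^sub>i\<^sub>2 c\<^sub>2 x\<^sup>n\<^sup>-\<^sup>1 + \<dots> + a\<^sub>i\<^sub>,\<^sub>n\<^sub>+\<^sub>1 c\<^sub>n\<^sub>+\<^sub>1\<close>.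
  All indices of \<open>a\<close> and \<open>c\<close> start at 1.
\<close>

definition row_poly :: "(nat \<Rightarrow> nat \<Rightarrow> int) \<Rightarrow> nat \<Rightarrow> nat \<Rightarrow> (nat \<Rightarrow> int) \<Rightarrow> int poly" where
  "row_poly a i n c = (\<Sum>k=1..n+1. monom (a i k * c k) (n + 1 - k))"

definition G_curve :: "nat \<Rightarrow> (nat \<Rightarrow> nat \<Rightarrow> int) \<Rightarrow> (nat \<Rightarrow> int) \<Rightarrow> int poly poly" where
  "G_curve m a c = square_curve (row_poly a 3 (2*m+1) c)"

definition C_curve :: "nat \<Rightarrow> (nat \<Rightarrow> nat \<Rightarrow> int) \<Rightarrow> (nat \<Rightarrow> int) \<Rightarrow> int poly poly" where
  "C_curve m a c = square_curve (row_poly a 6 (2*m) c)"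

definition V_curve :: "nat \<Rightarrow> (nat \<Rightarrow> nat \<Rightarrow> int) \<Rightarrow> (nat \<Rightarrow> int) \<Rightarrow> int poly poly" where
  "V_curve t a c = square_curve (row_poly a 9 (2*t) c)"

definition epsilon :: "nat \<Rightarrow> nat \<Rightarrow> int" where
  "epsilon m j = (2 * int m + 1 - int j) * (2 * int m - int j - 1)"

definition varepsilon :: "nat \<Rightarrow> nat \<Rightarrow> int" where
  "varepsilon m j = (2 * int m - int j) * (2 * int m - int j - 2)"

definition eta :: "nat \<Rightarrow> nat \<Rightarrow> int" where
  "eta t j = (2 * int t - int j) * (2 * int t - int j - 2)"

text \<open>
  \<open>row_support m t i\<close> is the set of those \<open>j\<close> for which \<open>a\<^sub>i\<^sub>j\<close> occurs in the
  \<open>i\<close>-th equation of the system below.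
\<close>

definition row_support :: "nat \<Rightarrow> nat \<Rightarrow> nat \<Rightarrow> nat set" where
  "row_support m t i =
     (if i = 1 then {1..2*m-1} \<union> {2*m+1}
      else if i = 2 then {1..2*m+1}
      else if i = 3 then {1..2*m+2}
      else if i = 4 then {1..2*m-2} \<union> {2*m}
      else if i = 5 then {1..2*m}
      else if i = 6 then {1..2*m+1}
      else if i = 7 then {1..2*t}
      else if i = 8 then {1..2*t-2} \<union> {2*t}
      else if i = 9 then {1..2*t+1}
      else {})"

definition rows_agree :: "nat \<Rightarrow> nat \<Rightarrow> (nat \<Rightarrow> nat \<Rightarrow> int) \<Rightarrow> nat set \<Rightarrow> bool" where
  "rows_agree m t a I \<longleftrightarrow>
     (\<forall>i\<in>I. \<forall>k\<in>I. \<forall>j \<in> row_support m t i \<inter> row_support m t k. a i j = a k j)"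

text \<open>
  Vectors of \<open>\<int>\<^sup>2\<^sup>m\<^sup>+\<^sup>2\<close> are extensional functions on \<open>{1..2*m+2}\<close>.
  The sums running up to \<open>2m - 3\<close> and \<open>2t - 3\<close> are written with half-open intervals, so that
  the latter is empty for \<open>t = 1\<close> in spite of truncated subtraction.
\<close>

definition solutions ::
  "nat \<Rightarrow> nat \<Rightarrow> (nat \<Rightarrow> nat \<Rightarrow> int) \<Rightarrow> int \<Rightarrow> int \<Rightarrow> int \<Rightarrow> int \<Rightarrow> int \<Rightarrow> int \<Rightarrow> (nat \<Rightarrow> int) set" where
  "solutions m t a d v t' u s q =
     {c \<in> {1..2*m+2} \<rightarrow>\<^sub>E UNIV.
        (\<Sum>j=0..2*m-2. (-1)^(j+1) * a 1 (j+1) * epsilon m j * c (j+1))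
            + a 1 (2*m+1) * c (2*m+1) = 4 * d - 1 \<and>
        (\<Sum>j=0..2*m. (-1)^j * a 2 (j+1) * c (j+1)) = 4 * v - 1 \<and>
        (\<Sum>j=0..2*m+1. (-1)^j * a 3 (j+1) * c (j+1)) = 1 \<and>
        (\<Sum>j=0..<2*m-2. (-1)^j * a 4 (j+1) * varepsilon m j * c (j+1))
            + a 4 (2*m) * c (2*m) = 4 * t' - 1 \<and>
        (\<Sum>j=0..2*m-1. (-1)^(j+1) * a 5 (j+1) * c (j+1)) = 4 * u - 1 \<and>
        (\<Sum>j=0..2*m. (-1)^(j+1) * a 6 (j+1) * c (j+1)) = 1 \<and>
        (\<Sum>j=0..2*t-1. (-1)^(j+1) * a 7 (j+1) * c (j+1)) = 4 * s - 1 \<and>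
        (\<Sum>j=0..<2*t-2. (-1)^j * a 8 (j+1) * eta t j * c (j+1))
            + a 8 (2*t) * c (2*t) = 4 * q - 1 \<and>
        (\<Sum>j=0..2*t. (-1)^(j+1) * a 9 (j+1) * c (j+1)) = 1}"

end

theory Submission imports Defs begin

text \<open>
  All three right-hand sides are integer polynomials \<open>f\<close> for which the three equations of the
  system involving their coefficients imply, whatever the parity of the degree, the same values:
  \<open>f(-1) = -1\<close>, \<open>f(0) \<equiv> 2 (mod 4)\<close> and \<open>f(1) \<equiv> 5 (mod 8)\<close> (lemma \<open>row_poly_values\<close>).
  The last congruence comes from the equation with the weights \<open>e(e - 2)\<close>, where \<open>e\<close> is an
  exponent: modulo 4 these weights see only the odd exponents, so this equation gives half of
  \<open>f(1) - f(-1)\<close> modulo 4.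

  Such an \<open>f\<close> takes no square value at any \<open>x \<ge> 0\<close> (lemma \<open>poly_value_not_square\<close>).
  Since \<open>f(-1) = -1\<close>, one can write \<open>f + 1 = (x + 1) g\<close> with \<open>g \<in> \<int>[x]\<close>, and a point
  on \<open>y\<^sup>2 = f(x)\<close> yields the factorisation \<open>y\<^sup>2 + 1 = (x + 1) g(x)\<close> into positive integers.
  By the first supplement to quadratic reciprocity, every positive divisor of \<open>y\<^sup>2 + 1\<close> is
  \<open>1\<close> or \<open>2\<close> modulo 4.  For \<open>x + 1\<close> this leaves \<open>x \<equiv> 0\<close>, where \<open>f(x) \<equiv> 2 (mod 4)\<close> is
  not a square, and \<open>x \<equiv> 1\<close>, where \<open>g(x) \<equiv> g(1) = (f(1) + 1) / 2 \<equiv> 3 (mod 4)\<close> is an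
  excluded divisor.
\<close>

section \<open>Divisors of \<open>y\<^sup>2 + 1\<close>\<close>

text \<open>
  Infinite descent on \<open>n\<close> replaces the passage to a prime factor.  As \<open>n\<close> is odd, the root of
  \<open>-1\<close> modulo \<open>n\<close> may be taken even and in \<open>[0, n)\<close>; the cofactor of \<open>n\<close> in \<open>z\<^sup>2 + 1\<close> is
  then smaller than \<open>n\<close> and, because \<open>z\<^sup>2 + 1 \<equiv> 1 (mod 4)\<close>, again \<open>3\<close> modulo 4.
\<close>

lemma not_dvd_square_plus_one_if_3_mod_4:
  fixes n y :: int
  assumes "0 < n" and "n mod 4 = 3"
  shows "\<not> n dvd y\<^sup>2 + 1"
  using assms
proof (induction "nat n" arbitrary: n y rule: less_induct)
  case less
  show ?case
  proof
    assume dvd: "n dvd y\<^sup>2 + 1"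
    define r where "r = y mod n"
    define z where "z = (if even r then r else n - r)"
    have n: "3 \<le> n" "odd n"
      using less.prems by presburger+
    have r: "0 \<le> r" "r < n"
      using less.prems by (simp_all add: r_def)
    have z: "even z" "0 \<le> z" "z \<le> n - 1"
      using r n by (auto simp: z_def order_le_less)
    have "n dvd z - y \<or> n dvd z + y"
    proof (cases "even r")
      case True
      have "n dvd r - y"
        unfolding r_def by (simp add: mod_eq_dvd_iff[symmetric])
      with True show ?thesis by (simp add: z_def)
    next
      case False
      have "n dvd y - r"
        unfolding r_def by simp
      then have "n dvd n + (y - r)" by simp
      with False show ?thesis by (simp add: z_def algebra_simps)
    qed
    then have "n dvd (z - y) * (z + y)" by auto
    then have "n dvd (z - y) * (z + y) + (y\<^sup>2 + 1)"
      using dvd by (rule dvd_add)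
    then have "n dvd z\<^sup>2 + 1"
      by (simp add: algebra_simps power2_eq_square)
    then obtain k where k: "z\<^sup>2 + 1 = n * k" ..
    have "0 < n * k"
      using k by (metis add.commute zero_less_one add_pos_nonneg zero_le_power2)
    then have "0 < k"
      using n by (simp add: zero_less_mult_iff)
    have "z * z \<le> (n - 1) * (n - 1)"
      using z n by (intro mult_mono) auto
    then have "n * k + 2 * n \<le> n * n + 2"
      using k by (simp add: algebra_simps power2_eq_square)
    then have "n * k < n * n"
      using n by linarith
    then have "k < n"
      using n by simp
    obtain w where "z = 2 * w"
      using z(1) ..
    then have "n * k = 4 * w\<^sup>2 + 1"
      using k by (simp add: power_mult_distrib)
    then have "(n * k) mod 4 = 1"
      by presburger
    then have "(n mod 4) * (k mod 4) mod 4 = 1"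
      by (simp only: mod_mult_eq)
    then have "3 * (k mod 4) mod 4 = 1"
      unfolding less.prems(2) .
    then have "k mod 4 = 3"
      by presburger
    moreover have "k dvd z\<^sup>2 + 1"
      using k by simp
    ultimately show False
      using less.hyps[of k z] \<open>0 < k\<close> \<open>k < n\<close> by simp
  qed
qed

lemma dvd_square_plus_one_mod_4:
  fixes n y :: int
  assumes "0 < n" and "n dvd y\<^sup>2 + 1"
  shows "n mod 4 = 1 \<or> n mod 4 = 2"
proof -
  have "\<not> 4 dvd y\<^sup>2 + 1"
  proof (cases "even y")
    case True
    then obtain w where "y = 2 * w" ..
    then have "y\<^sup>2 + 1 = 4 * w\<^sup>2 + 1"
      by (simp add: power_mult_distrib)
    then show ?thesis by presburger
  next
    case False
    then obtain w where "y = 2 * w + 1" by (rule oddE)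
    then have "y\<^sup>2 + 1 = 4 * (w\<^sup>2 + w) + 2"
      by (simp add: power2_eq_square algebra_simps)
    then show ?thesis by presburger
  qed
  then have "n mod 4 \<noteq> 0"
    using assms(2) by (meson dvd_trans mod_0_imp_dvd)
  moreover have "n mod 4 \<noteq> 3"
    using not_dvd_square_plus_one_if_3_mod_4 assms by blast
  ultimately show ?thesis by presburger
qed

section \<open>Polynomials without square values\<close>

lemma diff_dvd_poly_diff:
  fixes p :: "'a::comm_ring_1 poly"
  shows "x - y dvd poly p x - poly p y"
proof (induction p)
  case (pCons c p)
  have "poly (pCons c p) x - poly (pCons c p) y
      = x * (poly p x - poly p y) + (x - y) * poly p y"
    by (simp add: algebra_simps)
  with pCons show ?case by simp
qed simp

lemma poly_cong_mod:
  fixes p :: "int poly"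
  assumes "x mod k = y mod k"
  shows "poly p x mod k = poly p y mod k"
  using assms diff_dvd_poly_diff[of x y p] by (metis dvd_trans mod_eq_dvd_iff)

text \<open>
  Each factor of \<open>y\<^sup>2 + 1 = (x + 1) g(x)\<close> is needed: \<open>x + 1\<close> disposes of
  \<open>x \<equiv> 2, 3 (mod 4)\<close>, and \<open>g(x)\<close> of \<open>x \<equiv> 1\<close>, where congruences for \<open>f(x)\<close> itself
  to powers of 2 do not suffice: \<open>f(x)\<close> may well be a 2-adic square there.
\<close>

lemma poly_value_not_square:
  fixes f :: "int poly"
  assumes "poly f (-1) = -1" and "poly f 0 mod 4 = 2" and "poly f 1 mod 8 = 5"
    and "0 \<le> x"
  shows "poly f x \<noteq> y\<^sup>2"
proof
  assume y: "poly f x = y\<^sup>2"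
  have "poly (f + 1) (-1) = 0"
    using assms(1) by simp
  then have "[:1, 1:] dvd f + 1"
    using poly_eq_0_iff_dvd[of "f + 1" "-1"] by simp
  then obtain g where g: "f + 1 = [:1, 1:] * g" ..
  have fg: "poly f z + 1 = (z + 1) * poly g z" for z
    using arg_cong[OF g, of "\<lambda>p. poly p z"] by (simp add: algebra_simps)
  have fact: "y\<^sup>2 + 1 = (x + 1) * poly g x"
    using fg[of x] y by simp
  have "0 < (x + 1) * poly g x"
    unfolding fact[symmetric] by (simp add: add_nonneg_pos)
  then have "0 < poly g x"
    using assms(4) by (simp add: zero_less_mult_iff)
  have g_mod: "poly g x mod 4 = 1 \<or> poly g x mod 4 = 2"
    using dvd_square_plus_one_mod_4[of "poly g x" y] \<open>0 < poly g x\<close> fact by simp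
  have "(x + 1) mod 4 = 1 \<or> (x + 1) mod 4 = 2"
    using dvd_square_plus_one_mod_4[of "x + 1" y] assms(4) fact by simp
  then have "x mod 4 = 0 \<or> x mod 4 = 1"
    by presburger
  then consider "x mod 4 = 0" | "x mod 4 = 1"
    by blast
  then show False
  proof cases
    case 1
    then have "poly f x mod 4 = 2"
      using poly_cong_mod[of x 4 0 f] assms(2) by simp
    then have "y\<^sup>2 mod 4 = 2"
      using y by simp
    moreover have "0 < y\<^sup>2 + 1"
      by (simp add: add_nonneg_pos)
    then have "(y\<^sup>2 + 1) mod 4 = 1 \<or> (y\<^sup>2 + 1) mod 4 = 2"
      by (rule dvd_square_plus_one_mod_4) (rule dvd_refl)
    ultimately show False
      by presburger
  next
    case 2
    then have "poly g x mod 4 = poly g 1 mod 4"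
      using poly_cong_mod[of x 4 1 g] by simp
    moreover have "poly g 1 mod 4 = 3"
      using fg[of 1] assms(3) by simp presburger
    ultimately show False
      using g_mod by simp
  qed
qed

section \<open>The equations of the system as conditions on values\<close>

lemma poly_row_poly:
  "poly (row_poly a i n c) x = (\<Sum>j=0..n. a i (j + 1) * c (j + 1) * x ^ (n - j))"
proof -
  have "poly (row_poly a i n c) x = (\<Sum>k=1..n + 1. a i k * c k * x ^ (n + 1 - k))"
    by (simp add: row_poly_def poly_sum poly_monom del: sum.cl_ivl_Suc)
  also have "\<dots> = (\<Sum>j=0..n. a i (j + 1) * c (j + 1) * x ^ (n - j))"
    by (rule sum.reindex_bij_witness[of _ "\<lambda>j. j + 1" "\<lambda>k. k - 1"]) auto
  finally show ?thesis .
qed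

text \<open>
  Modulo 4 the weight \<open>e(e - 2) = (e - 1)\<^sup>2 - 1\<close> is \<open>0\<close> for even and \<open>-1\<close> for odd \<open>e\<close>, so
  with the sign \<open>(-1)\<^sup>e\<close> it is half of \<open>1\<^sup>e - (-1)\<^sup>e\<close>.  Summed over the terms of \<open>f\<close>, this
  compares the weighted equation with \<open>f(1) - f(-1)\<close>.
\<close>

lemma weight_cong_mod_8:
  "(8::int) dvd 1 - (-1) ^ e - 2 * ((-1) ^ e * (int e * (int e - 2)))"
proof (cases "even e")
  case True
  then obtain h where "e = 2 * h" ..
  then have "1 - (-1) ^ e - 2 * ((-1) ^ e * (int e * (int e - 2))) = 8 * (int h * (1 - int h))"
    by (simp add: algebra_simps)
  then show ?thesis by simp
next
  case False
  then obtain h where "e = 2 * h + 1" by (rule oddE)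
  then have "1 - (-1) ^ e - 2 * ((-1) ^ e * (int e * (int e - 2))) = 8 * (int h * int h)"
    by (simp add: algebra_simps)
  then show ?thesis by simp
qed

text \<open>
  The common form of the three groups of equations.  The sign \<open>(-1)\<^sup>n\<^sup>-\<^sup>j\<close> is the value at
  \<open>-1\<close> of the power that goes with the coefficient of index \<open>j + 1\<close>.  In the weighted equation
  the exponents \<open>2\<close> and \<open>0\<close> are missing, because \<open>e(e - 2)\<close> vanishes there, and exponent \<open>1\<close>
  appears as the separate summand.
\<close>

lemma row_poly_values:
  assumes "2 \<le> n"
    and weighted: "(\<Sum>j=0..<n - 2. (-1) ^ (n - j) * a i (j + 1)
                     * ((int n - int j) * (int n - int j - 2)) * c (j + 1))
                   + a i n * c n = 4 * d - 1"
    and partial: "(\<Sum>j=0..<n. (-1) ^ (n - j) * a i (j + 1) * c (j + 1)) = 1 - 4 * v"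
    and total: "(\<Sum>j=0..n. (-1) ^ (n - j) * a i (j + 1) * c (j + 1)) = -1"
  shows "poly (row_poly a i n c) (-1) = -1"
    and "poly (row_poly a i n c) 0 mod 4 = 2"
    and "poly (row_poly a i n c) 1 mod 8 = 5"
proof -
  let ?f = "row_poly a i n c"
  define b where "b j = a i (j + 1) * c (j + 1)" for j
  define w where "w e = (-1) ^ e * (int e * (int e - 2))" for e
  have f: "poly ?f x = (\<Sum>j=0..n. b j * x ^ (n - j))" for x
    by (simp add: poly_row_poly b_def)
  show minus_one: "poly ?f (-1) = -1"
    using total by (simp add: f b_def mult_ac)
  have "poly ?f 0 = (\<Sum>j=0..n. if j = n then b n else 0)"
    unfolding f by (intro sum.cong) auto
  then have "poly ?f 0 = b n"
    by simp
  moreover have "(\<Sum>j=0..<n. (-1) ^ (n - j) * b j) + b n = -1"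
    using total by (simp add: b_def mult_ac atLeastLessThanSuc_atLeastAtMost[symmetric])
  ultimately have "poly ?f 0 = 4 * v - 2"
    using partial by (simp add: b_def mult_ac)
  then show "poly ?f 0 mod 4 = 2"
    by presburger
  have "(\<Sum>j=0..n. b j * w (n - j)) = 4 * d - 1"
  proof -
    obtain k where k: "n = k + 2"
      using assms(1) by (metis add.commute le_Suc_ex)
    have "(\<Sum>j=0..n. b j * w (n - j)) = (\<Sum>j=0..<k. b j * w (n - j)) + b (k + 1)"
      by (simp add: k w_def)
        (simp add: atLeastLessThanSuc_atLeastAtMost[symmetric])
    also have "(\<Sum>j=0..<k. b j * w (n - j)) = (\<Sum>j=0..<n - 2. (-1) ^ (n - j) * a i (j + 1)
        * ((int n - int j) * (int n - int j - 2)) * c (j + 1))"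
      by (rule sum.cong) (auto simp: k w_def b_def of_nat_diff mult_ac)
    finally show ?thesis
      using weighted by (simp add: b_def k)
  qed
  moreover have "8 dvd (\<Sum>j=0..n. b j * (1 - (-1) ^ (n - j) - 2 * w (n - j)))"
    unfolding w_def by (intro dvd_sum dvd_mult weight_cong_mod_8)
  then have "8 dvd poly ?f 1 - poly ?f (-1) - 2 * (\<Sum>j=0..n. b j * w (n - j))"
    by (simp add: f algebra_simps sum_subtractf sum.distrib sum_distrib_left)
  ultimately have "8 dvd poly ?f 1 + 3 - 8 * d"
    using minus_one by (simp add: add.commute add_diff_eq)
  then show "poly ?f 1 mod 8 = 5"
    by presburger
qed

lemma pos_int_points_square_curve_empty:
  assumes "poly f (-1) = -1" and "poly f 0 mod 4 = 2" and "poly f 1 mod 8 = 5"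
  shows "pos_int_points (square_curve f) = {}"
proof -
  have "eval2 (square_curve f) x y = y\<^sup>2 - poly f x" for x y
    by (simp add: eval2_def square_curve_def power2_eq_square)
  then show ?thesis
    using poly_value_not_square[OF assms] by (fastforce simp: pos_int_points_def dest: sym)
qed

lemma rows_agreeD:
  assumes "rows_agree m t a I" and "i \<in> I" and "k \<in> I"
    and "j \<in> row_support m t i" and "j \<in> row_support m t k"
  shows "a i j = a k j"
  using assms unfolding rows_agree_def by blast

text \<open>
  The next two lemmas read off the hypotheses of \<open>row_poly_values\<close> from a group of three
  equations whose rows \<open>i\<^sub>1\<close>, \<open>i\<^sub>2\<close>, \<open>i\<close> agree wherever they occur; row \<open>i\<close> defines the curve.
  For degree \<open>2k\<close> the sign \<open>(-1)\<^sup>n\<^sup>-\<^sup>j\<close> is \<open>(-1)\<^sup>j\<close>, for degree \<open>2k + 1\<close> it is \<open>-(-1)\<^sup>j\<close>.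
\<close>

lemma even_degree_curve_no_points:
  fixes a :: "nat \<Rightarrow> nat \<Rightarrow> int"
  assumes "1 \<le> k"
    and row1: "\<And>j. j \<in> {1..2*k-2} \<union> {2*k} \<Longrightarrow> a i\<^sub>1 j = a i j"
    and row2: "\<And>j. j \<in> {1..2*k} \<Longrightarrow> a i\<^sub>2 j = a i j"
    and weighted: "(\<Sum>j=0..<2*k-2. (-1)^j * a i\<^sub>1 (j+1) * eta k j * c (j+1))
                   + a i\<^sub>1 (2*k) * c (2*k) = 4 * d - 1"
    and partial: "(\<Sum>j=0..2*k-1. (-1)^(j+1) * a i\<^sub>2 (j+1) * c (j+1)) = 4 * v - 1"
    and total: "(\<Sum>j=0..2*k. (-1)^(j+1) * a i (j+1) * c (j+1)) = 1"
  shows "pos_int_points (square_curve (row_poly a i (2*k) c)) = {}"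
proof -
  have sign: "(-1) ^ (2 * k - j) = ((-1) ^ j :: int)" if "j \<le> 2 * k" for j
    using that by (simp add: minus_one_power_iff)
  have "(\<Sum>j=0..<2*k-2. (-1) ^ (2*k - j) * a i (j + 1)
            * ((int (2*k) - int j) * (int (2*k) - int j - 2)) * c (j + 1))
      = (\<Sum>j=0..<2*k-2. (-1)^j * a i\<^sub>1 (j+1) * eta k j * c (j+1))"
    by (rule sum.cong) (auto simp: sign eta_def row1)
  then have W: "(\<Sum>j=0..<2*k-2. (-1) ^ (2*k - j) * a i (j + 1)
            * ((int (2*k) - int j) * (int (2*k) - int j - 2)) * c (j + 1))
         + a i (2*k) * c (2*k) = 4 * d - 1"
    using weighted row1[of "2*k"] by simp
  have "(\<Sum>j=0..<2*k. (-1) ^ (2*k - j) * a i (j + 1) * c (j + 1))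
      = - (\<Sum>j=0..2*k-1. (-1)^(j+1) * a i\<^sub>2 (j+1) * c (j+1))"
    unfolding sum_negf[symmetric]
    using assms(1) by (intro sum.cong) (auto simp: sign row2)
  then have P: "(\<Sum>j=0..<2*k. (-1) ^ (2*k - j) * a i (j + 1) * c (j + 1)) = 1 - 4 * v"
    using partial by simp
  have "(\<Sum>j=0..2*k. (-1) ^ (2*k - j) * a i (j + 1) * c (j + 1))
      = - (\<Sum>j=0..2*k. (-1)^(j+1) * a i (j+1) * c (j+1))"
    unfolding sum_negf[symmetric] by (rule sum.cong) (auto simp: sign)
  then have T: "(\<Sum>j=0..2*k. (-1) ^ (2*k - j) * a i (j + 1) * c (j + 1)) = -1"
    using total by simp
  have "2 \<le> 2 * k"
    using assms(1) by simp
  from row_poly_values[where n = "2*k" and a = a and i = i and c = c, OF this W P T]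
  show ?thesis
    by (rule pos_int_points_square_curve_empty)
qed

lemma odd_degree_curve_no_points:
  fixes a :: "nat \<Rightarrow> nat \<Rightarrow> int"
  assumes "1 \<le> k"
    and row1: "\<And>j. j \<in> {1..2*k-1} \<union> {2*k+1} \<Longrightarrow> a i\<^sub>1 j = a i j"
    and row2: "\<And>j. j \<in> {1..2*k+1} \<Longrightarrow> a i\<^sub>2 j = a i j"
    and weighted: "(\<Sum>j=0..2*k-2. (-1)^(j+1) * a i\<^sub>1 (j+1) * epsilon k j * c (j+1))
                   + a i\<^sub>1 (2*k+1) * c (2*k+1) = 4 * d - 1"
    and partial: "(\<Sum>j=0..2*k. (-1)^j * a i\<^sub>2 (j+1) * c (j+1)) = 4 * v - 1"
    and total: "(\<Sum>j=0..2*k+1. (-1)^j * a i (j+1) * c (j+1)) = 1"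
  shows "pos_int_points (square_curve (row_poly a i (2*k+1) c)) = {}"
proof -
  have sign: "(-1) ^ (2 * k + 1 - j) = (- ((-1) ^ j) :: int)" if "j \<le> 2 * k + 1" for j
    using that by (auto simp add: minus_one_power_iff)
  have "(\<Sum>j=0..<2*k+1-2. (-1) ^ (2*k+1 - j) * a i (j + 1)
            * ((int (2*k+1) - int j) * (int (2*k+1) - int j - 2)) * c (j + 1))
      = (\<Sum>j=0..2*k-2. (-1)^(j+1) * a i\<^sub>1 (j+1) * epsilon k j * c (j+1))"
  proof (rule sum.cong)
    show "{0..<2*k+1-2} = {0..2*k-2}"
      using assms(1) by auto
    fix j assume j: "j \<in> {0..2*k-2}"
    have "int (2*k+1) - int j - 2 = 2 * int k - int j - 1"
      by simp
    moreover have "a i\<^sub>1 (j+1) = a i (j+1)"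
      using j assms(1) by (intro row1) auto
    ultimately show "(-1) ^ (2*k+1 - j) * a i (j + 1)
            * ((int (2*k+1) - int j) * (int (2*k+1) - int j - 2)) * c (j + 1)
        = (-1)^(j+1) * a i\<^sub>1 (j+1) * epsilon k j * c (j+1)"
      using j sign[of j] by (simp add: epsilon_def add.commute)
  qed
  then have W: "(\<Sum>j=0..<2*k+1-2. (-1) ^ (2*k+1 - j) * a i (j + 1)
            * ((int (2*k+1) - int j) * (int (2*k+1) - int j - 2)) * c (j + 1))
         + a i (2*k+1) * c (2*k+1) = 4 * d - 1"
    using weighted row1[of "2*k+1"] by simp
  have "(\<Sum>j=0..<2*k+1. (-1) ^ (2*k+1 - j) * a i (j + 1) * c (j + 1))
      = - (\<Sum>j=0..2*k. (-1)^j * a i\<^sub>2 (j+1) * c (j+1))"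
    unfolding sum_negf[symmetric]
  proof (rule sum.cong)
    fix j assume "j \<in> {0..2*k}"
    then show "(-1) ^ (2*k+1 - j) * a i (j + 1) * c (j + 1)
        = - ((-1)^j * a i\<^sub>2 (j+1) * c (j+1))"
      using sign[of j] row2[of "j+1"] by simp
  qed auto
  then have P: "(\<Sum>j=0..<2*k+1. (-1) ^ (2*k+1 - j) * a i (j + 1) * c (j + 1)) = 1 - 4 * v"
    using partial by simp
  have "(\<Sum>j=0..2*k+1. (-1) ^ (2*k+1 - j) * a i (j + 1) * c (j + 1))
      = - (\<Sum>j=0..2*k+1. (-1)^j * a i (j+1) * c (j+1))"
    unfolding sum_negf[symmetric]
  proof (rule sum.cong)
    fix j assume "j \<in> {0..2*k+1}"
    then show "(-1) ^ (2*k+1 - j) * a i (j + 1) * c (j + 1)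
        = - ((-1)^j * a i (j+1) * c (j+1))"
      using sign[of j] by simp
  qed auto
  then have T: "(\<Sum>j=0..2*k+1. (-1) ^ (2*k+1 - j) * a i (j + 1) * c (j + 1)) = -1"
    using total by simp
  have "2 \<le> 2 * k + 1"
    using assms(1) by simp
  from row_poly_values[where n = "2*k+1" and a = a and i = i and c = c, OF this W P T]
  show ?thesis
    by (rule pos_int_points_square_curve_empty)
qed

theorem theorem4p4:
  fixes m t :: nat
    and v u d t' s q :: int
    and a :: "nat \<Rightarrow> nat \<Rightarrow> int"
  assumes "1 \<le> t" and "t < m"
    and "0 \<le> v" and "0 \<le> u" and "0 \<le> d" and "0 \<le> t'" and "0 \<le> s" and "0 \<le> q"
    and "rows_agree m t a {1, 2, 3}"
    and "rows_agree m t a {4, 5, 6}"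
    and "rows_agree m t a {7, 8, 9}"
    and "\<forall>c \<in> solutions m t a d v t' u s q.
           nonsingular_curve (G_curve m a c) \<and> curve_degree (G_curve m a c) = 2 * m + 1 \<and>
           nonsingular_curve (C_curve m a c) \<and> curve_degree (C_curve m a c) = 2 * m \<and>
           nonsingular_curve (V_curve t a c) \<and> curve_degree (V_curve t a c) = 2 * t"
    and "\<forall>c \<in> solutions m t a d v t' u s q.
           (\<forall>(x, y) \<in> pos_int_points (C_curve m a c). x > 1 \<and> y \<ge> 1) \<and>
           (\<forall>(x, y) \<in> pos_int_points (G_curve m a c). x > 1 \<and> y \<ge> 1) \<and>
           (\<forall>(x, y) \<in> pos_int_points (V_curve t a c). x > 1 \<and> y \<ge> 1)"
  shows "\<forall>c \<in> solutions m t a d v t' u s q.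
           pos_int_points (C_curve m a c) = {} \<and>
           pos_int_points (G_curve m a c) = {} \<and>
           pos_int_points (V_curve t a c) = {}"
proof
  fix c
  assume "c \<in> solutions m t a d v t' u s q"
  note eqs = this[unfolded solutions_def mem_Collect_eq]
  have m: "1 \<le> m"
    using assms(1,2) by simp
  have "pos_int_points (C_curve m a c) = {}"
    unfolding C_curve_def
  proof (rule even_degree_curve_no_points[where i\<^sub>1 = 4 and i\<^sub>2 = 5, OF m])
    show "a 4 j = a 6 j" if "j \<in> {1..2*m-2} \<union> {2*m}" for j
      using that m by (intro rows_agreeD[OF assms(10)]) (auto simp: row_support_def)
    show "a 5 j = a 6 j" if "j \<in> {1..2*m}" for j
      using that by (intro rows_agreeD[OF assms(10)]) (auto simp: row_support_def)
    have "eta m = varepsilon m"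
      by (simp add: fun_eq_iff eta_def varepsilon_def)
    then show "(\<Sum>j=0..<2*m-2. (-1)^j * a 4 (j+1) * eta m j * c (j+1))
        + a 4 (2*m) * c (2*m) = 4 * t' - 1"
      using eqs by simp
  qed (use eqs in blast)+
  moreover have "pos_int_points (G_curve m a c) = {}"
    unfolding G_curve_def
  proof (rule odd_degree_curve_no_points[where i\<^sub>1 = 1 and i\<^sub>2 = 2, OF m])
    show "a 1 j = a 3 j" if "j \<in> {1..2*m-1} \<union> {2*m+1}" for j
      using that by (intro rows_agreeD[OF assms(9)]) (auto simp: row_support_def)
    show "a 2 j = a 3 j" if "j \<in> {1..2*m+1}" for j
      using that by (intro rows_agreeD[OF assms(9)]) (auto simp: row_support_def)
  qed (use eqs in blast)+
  moreover have "pos_int_points (V_curve t a c) = {}"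
    unfolding V_curve_def
  proof (rule even_degree_curve_no_points[where i\<^sub>1 = 8 and i\<^sub>2 = 7, OF assms(1)])
    show "a 8 j = a 9 j" if "j \<in> {1..2*t-2} \<union> {2*t}" for j
      using that assms(1) by (intro rows_agreeD[OF assms(11)]) (auto simp: row_support_def)
    show "a 7 j = a 9 j" if "j \<in> {1..2*t}" for j
      using that by (intro rows_agreeD[OF assms(11)]) (auto simp: row_support_def)
  qed (use eqs in blast)+
  ultimately show "pos_int_points (C_curve m a c) = {} \<and>
      pos_int_points (G_curve m a c) = {} \<and> pos_int_points (V_curve t a c) = {}"
    by blast
qed

end
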